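(* Let $n\ge 2$. Let $\mathcal{M}\subset\mathbb{C}^{n\times n}$ be the set of matrices having multiple eigenvalues and let $\mathcal{D}\subset\mathbb{C}^{n\times n}$ be the set of defective matrices. Then $\overline{\mathcal{D}}=\mathcal{M}$, where $\overline{\mathcal{D}}$ denotes the topological closure of $\mathcal{D}$ in $\mathbb{C}^{n\times n}$.
   Context: A matrix has multiple eigenvalues if at least one of its eigenvalues has algebraic multiplicity at least $2$. A square matrix is defective if it has at least one eigenvalue whose algebraic multiplicity is strictly larger than its geometric multiplicity. $\mathbb{C}^{n\times n}$ carries the metric $d(X,Y)=\|X-Y\|_F$ induced by the Frobenius norm. *)

theory Defs
  imports "HOL-Analysis.Analysis" "HOL-Computational_Algebra.Polynomial"
begin

definition mat_eigenvalue :: "'a::field^'n^'n \<Rightarrow> 'a \<Rightarrow> bool" where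
  "mat_eigenvalue A c \<longleftrightarrow> (\<exists>v. v \<noteq> 0 \<and> A *v v = c *s v)"

definition charpoly :: "'a::field^'n^'n \<Rightarrow> 'a poly" where
  "charpoly A = det (mat [:0, 1:] - (\<chi> i j. [:A $ i $ j:]))"

definition alg_mult :: "'a::field^'n^'n \<Rightarrow> 'a \<Rightarrow> nat" where
  "alg_mult A c = order c (charpoly A)"

(* vec.dim is the dimension over the scalar field 'a; the library's plain dim is
   the dimension over the reals, which would be doubled for complex matrices. *)
definition geom_mult :: "'a::field^'n^'n \<Rightarrow> 'a \<Rightarrow> nat" where
  "geom_mult A c = vec.dim {v. A *v v = c *s v}"

definition has_multiple_eigenvalues :: "'a::field^'n^'n \<Rightarrow> bool" where
  "has_multiple_eigenvalues A \<longleftrightarrow> (\<exists>c. mat_eigenvalue A c \<and> alg_mult A c \<ge> 2)"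

definition defective :: "'a::field^'n^'n \<Rightarrow> bool" where
  "defective A \<longleftrightarrow> (\<exists>c. mat_eigenvalue A c \<and> alg_mult A c > geom_mult A c)"

(* The library metric on complex^'n^'n, which determines closure, is the one
   induced by the Frobenius norm. *)
lemma dist_eq_frobenius:
  fixes X Y :: "complex^'n^'n"
  shows "dist X Y = sqrt (\<Sum>i\<in>UNIV. \<Sum>j\<in>UNIV. (cmod (X $ i $ j - Y $ i $ j))\<^sup>2)"
  by (simp add: dist_vec_def L2_set_def dist_norm sum_nonneg)

end

theory Submission
  imports Defs
begin

text \<open>
  Eigenvalues are bounded by the entries of the matrix, so a limit of matrices whose
  characteristic polynomials share a root with their derivative has the same property: the set of
  matrices with multiple eigenvalues is closed. Conversely, suppose that an eigenvalue \<open>c\<close> of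
  \<open>A\<close> has two independent eigenvectors \<open>u\<close>, \<open>v\<close>, and choose \<open>N\<close> with
  \<open>N u = 0\<close>, \<open>N v = u\<close>. For every \<open>e \<noteq> 0\<close> the matrix \<open>A + e N\<close> has the
  Jordan chain \<open>v\<close>, \<open>e u\<close> for \<open>c\<close>, and a matrix with a Jordan chain of length two is
  defective.
\<close>

section \<open>Eigenvalues as roots of the characteristic polynomial\<close>

lemma poly_charpoly:
  fixes A :: "'a::field^'n^'n"
  shows "poly (charpoly A) t = det (mat t - A)"
proof -
  have "poly ((mat [:0, 1:] - (\<chi> i j. [:A $ i $ j:])) $ i $ j) t = (mat t - A) $ i $ j" for i j
    by (simp add: mat_def)
  then show ?thesis
    by (simp add: charpoly_def det_def poly_sum poly_prod)
qed

lemma det_eq_0_iff_kernel: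
  fixes A :: "'a::field^'n^'n"
  shows "det A = 0 \<longleftrightarrow> (\<exists>v. v \<noteq> 0 \<and> A *v v = 0)"
  by (metis invertible_det_nz invertible_left_inverse matrix_left_invertible_ker)

lemma mat_eigenvalue_iff_root:
  fixes A :: "'a::field^'n^'n"
  shows "mat_eigenvalue A c \<longleftrightarrow> poly (charpoly A) c = 0"
proof -
  have "(mat c - A) *v v = c *s v - A *v v" for v :: "'a^'n"
    unfolding matrix_vector_mult_diff_rdistrib
    by (simp add: vec_eq_iff matrix_vector_mult_def mat_def if_distrib if_distribR cong: if_cong)
  then show ?thesis
    by (auto simp: mat_eigenvalue_def poly_charpoly det_eq_0_iff_kernel)
qed

text \<open>Read \<open>A *v v = c *s v\<close> in the row \<open>i\<close> where the entry of
  \<open>v\<close> is largest in modulus and divide by that entry: the row sum bounds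
  \<open>c\<close>. The sum over all entries is cruder, but it does not depend on \<open>i\<close>
  and is continuous in \<open>A\<close>.\<close>

lemma mat_eigenvalue_bound:
  fixes A :: "complex^'n^'n"
  assumes "mat_eigenvalue A c"
  shows "cmod c \<le> (\<Sum>i\<in>UNIV. \<Sum>j\<in>UNIV. cmod (A $ i $ j))"
proof -
  obtain v where v: "v \<noteq> 0" "A *v v = c *s v"
    using assms by (auto simp: mat_eigenvalue_def)
  have "Max (range (\<lambda>j. cmod (v $ j))) \<in> range (\<lambda>j. cmod (v $ j))"
    by (rule Max_in) auto
  then obtain i where "Max (range (\<lambda>j. cmod (v $ j))) = cmod (v $ i)"
    by blast
  then have i: "cmod (v $ j) \<le> cmod (v $ i)" for j
    by (metis Max_ge finite finite_imageI rangeI)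
  have pos: "cmod (v $ i) > 0"
  proof -
    obtain j where "v $ j \<noteq> 0"
      using v(1) by (auto simp: vec_eq_iff)
    then have "0 < cmod (v $ j)"
      by simp
    then show ?thesis
      using i[of j] by linarith
  qed
  have "cmod c * cmod (v $ i) = cmod ((A *v v) $ i)"
    by (simp add: v norm_mult)
  also have "\<dots> \<le> (\<Sum>j\<in>UNIV. cmod (A $ i $ j) * cmod (v $ j))"
    by (auto simp: matrix_vector_mult_def norm_mult intro: sum_norm_le)
  also have "\<dots> \<le> (\<Sum>j\<in>UNIV. cmod (A $ i $ j)) * cmod (v $ i)"
    unfolding sum_distrib_right by (intro sum_mono mult_left_mono i) auto
  finally have "cmod c \<le> (\<Sum>j\<in>UNIV. cmod (A $ i $ j))"
    using pos by simp
  also have "\<dots> \<le> (\<Sum>i\<in>UNIV. \<Sum>j\<in>UNIV. cmod (A $ i $ j))"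
    by (rule member_le_sum) (auto intro: sum_nonneg)
  finally show ?thesis .
qed

text \<open>The zero polynomial would make every number an eigenvalue, against the bound
  above.\<close>

lemma charpoly_nonzero:
  fixes A :: "complex^'n^'n"
  shows "charpoly A \<noteq> 0"
proof
  assume "charpoly A = 0"
  then have "mat_eigenvalue A (of_real ((\<Sum>i\<in>UNIV. \<Sum>j\<in>UNIV. cmod (A $ i $ j)) + 1))"
    by (simp add: mat_eigenvalue_iff_root)
  from mat_eigenvalue_bound[OF this] show False
    unfolding norm_of_real by linarith
qed

section \<open>Multiple roots and the derivative\<close>

lemma order_ge_2_iff:
  fixes p :: "'a::field poly"
  assumes "p \<noteq> 0"
  shows "order c p \<ge> 2 \<longleftrightarrow> poly p c = 0 \<and> poly (pderiv p) c = 0"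
proof -
  have "[:- c, 1:] ^ 2 dvd p \<longleftrightarrow> poly p c = 0 \<and> poly (pderiv p) c = 0"
  proof
    define l where "l = [:- c, 1:]"
    assume "[:- c, 1:] ^ 2 dvd p"
    then obtain q where "p = l * (l * q)"
      by (auto simp: l_def[symmetric] dvd_def power2_eq_square mult.assoc)
    moreover have "poly l c = 0"
      by (simp add: l_def)
    ultimately show "poly p c = 0 \<and> poly (pderiv p) c = 0"
      by (simp add: pderiv_mult)
  next
    assume *: "poly p c = 0 \<and> poly (pderiv p) c = 0"
    then obtain q where q: "p = [:- c, 1:] * q"
      by (auto simp: poly_eq_0_iff_dvd)
    have "poly (pderiv ([:- c, 1:] * q)) c = poly q c"
      by (simp only: pderiv_mult poly_add poly_mult) (simp add: pderiv_pCons)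
    with * q have "poly q c = 0"
      by simp
    then show "[:- c, 1:] ^ 2 dvd p"
      unfolding q power2_eq_square by (intro mult_dvd_mono) (auto simp: poly_eq_0_iff_dvd)
  qed
  then show ?thesis
    using assms by (simp add: order_divides)
qed

lemma has_multiple_eigenvalues_iff:
  fixes A :: "complex^'n^'n"
  shows "has_multiple_eigenvalues A \<longleftrightarrow>
    (\<exists>c. poly (charpoly A) c = 0 \<and> poly (pderiv (charpoly A)) c = 0)"
  by (auto simp: has_multiple_eigenvalues_def alg_mult_def order_ge_2_iff charpoly_nonzero
      mat_eigenvalue_iff_root)

section \<open>Joint continuity and closedness\<close>

text \<open>Continuity is joint in parameter and argument because the matrix and its eigenvalue will
  both vary in a limit. Values and derivatives are kept together so that the product rule gives
  closure under products, hence under determinants.\<close>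

definition poly_C1 :: "('a::topological_space \<Rightarrow> complex poly) \<Rightarrow> bool" where
  "poly_C1 f \<longleftrightarrow> continuous_on UNIV (\<lambda>(a, z). poly (f a) z) \<and>
     continuous_on UNIV (\<lambda>(a, z). poly (pderiv (f a)) z)"

lemma poly_C1_const: "poly_C1 (\<lambda>_. p)"
  by (auto simp: poly_C1_def case_prod_unfold intro!: continuous_intros)

lemma poly_C1_mult: "poly_C1 f \<Longrightarrow> poly_C1 g \<Longrightarrow> poly_C1 (\<lambda>a. f a * g a)"
  by (auto simp: poly_C1_def case_prod_unfold pderiv_mult intro!: continuous_intros)

lemma poly_C1_diff: "poly_C1 f \<Longrightarrow> poly_C1 g \<Longrightarrow> poly_C1 (\<lambda>a. f a - g a)"
  by (auto simp: poly_C1_def case_prod_unfold pderiv_diff intro!: continuous_intros)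

lemma poly_C1_add: "poly_C1 f \<Longrightarrow> poly_C1 g \<Longrightarrow> poly_C1 (\<lambda>a. f a + g a)"
  by (auto simp: poly_C1_def case_prod_unfold pderiv_add intro!: continuous_intros)

lemma poly_C1_sum: "(\<And>i. i \<in> I \<Longrightarrow> poly_C1 (f i)) \<Longrightarrow> poly_C1 (\<lambda>a. \<Sum>i\<in>I. f i a)"
  by (induction I rule: infinite_finite_induct) (simp_all add: poly_C1_const poly_C1_add)

lemma poly_C1_prod: "(\<And>i. i \<in> I \<Longrightarrow> poly_C1 (f i)) \<Longrightarrow> poly_C1 (\<lambda>a. \<Prod>i\<in>I. f i a)"
  by (induction I rule: infinite_finite_induct) (simp_all add: poly_C1_const poly_C1_mult)

lemma poly_C1_charpoly: "poly_C1 (charpoly :: complex^'n^'n \<Rightarrow> complex poly)"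
proof -
  have entry: "poly_C1 (\<lambda>A. [:A $ i $ j:])" for i j :: 'n
    by (auto simp: poly_C1_def case_prod_unfold pderiv_pCons intro!: continuous_intros)
  show ?thesis
    unfolding charpoly_def det_def
    by (intro poly_C1_sum poly_C1_mult poly_C1_prod poly_C1_const)
       (simp add: entry poly_C1_diff poly_C1_const)
qed

text \<open>The chosen multiple eigenvalues \<open>c k\<close> need not converge. They are bounded,
  so a subsequence does, and joint continuity carries both root equations to its limit.\<close>

lemma closed_has_multiple_eigenvalues:
  "closed {A :: complex^'n^'n. has_multiple_eigenvalues A}"
  unfolding closed_sequential_limits
proof (intro allI impI; elim conjE)
  fix X :: "nat \<Rightarrow> complex^'n^'n" and A
  assume "\<forall>k. X k \<in> {A. has_multiple_eigenvalues A}" and X: "X \<longlonglongrightarrow> A"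
  then obtain c where c: "\<And>k. poly (charpoly (X k)) (c k) = 0"
      "\<And>k. poly (pderiv (charpoly (X k))) (c k) = 0"
    unfolding has_multiple_eigenvalues_iff mem_Collect_eq by metis
  have "(\<lambda>k. \<Sum>i\<in>UNIV. \<Sum>j\<in>UNIV. cmod (X k $ i $ j)) \<longlonglongrightarrow> (\<Sum>i\<in>UNIV. \<Sum>j\<in>UNIV. cmod (A $ i $ j))"
    by (intro tendsto_intros X)
  then have "Bseq (\<lambda>k. \<Sum>i\<in>UNIV. \<Sum>j\<in>UNIV. cmod (X k $ i $ j))"
    by (rule convergent_imp_Bseq[OF convergentI])
  then obtain K where K: "\<And>k. norm (\<Sum>i\<in>UNIV. \<Sum>j\<in>UNIV. cmod (X k $ i $ j)) \<le> K"
    by (auto simp: Bseq_def)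
  have "cmod (c k) \<le> K" for k
    using mat_eigenvalue_bound[of "X k" "c k"] c(1)[of k] K[of k]
    by (simp add: mat_eigenvalue_iff_root)
  then have "\<forall>k. c k \<in> cball 0 K"
    by simp
  then obtain z r where r: "strict_mono r" "(c \<circ> r) \<longlonglongrightarrow> z"
    using compact_cball[of "0::complex" K] unfolding compact_def by meson
  have pair: "(\<lambda>k. (X (r k), c (r k))) \<longlonglongrightarrow> (A, z)"
    using r LIMSEQ_subseq_LIMSEQ[OF X r(1)] by (intro tendsto_Pair) (auto simp: o_def)
  have lim: "f A z = 0"
    if "continuous_on UNIV (\<lambda>(A, z). f A z)" "\<And>k. f (X k) (c k) = 0"
    for f :: "complex^'n^'n \<Rightarrow> complex \<Rightarrow> complex"
  proof -
    have "(\<lambda>k. f (X (r k)) (c (r k))) \<longlonglongrightarrow> f A z"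
      using continuous_on_tendsto_compose[OF that(1) pair] by simp
    then show ?thesis
      using that(2) by (simp add: LIMSEQ_const_iff)
  qed
  show "A \<in> {A. has_multiple_eigenvalues A}"
    using poly_C1_charpoly[where 'n='n] c lim[of "\<lambda>A. poly (charpoly A)"]
      lim[of "\<lambda>A. poly (pderiv (charpoly A))"]
    unfolding has_multiple_eigenvalues_iff mem_Collect_eq poly_C1_def by blast
qed

section \<open>A Jordan chain forces defectiveness\<close>

text \<open>
  Let \<open>M = x - A\<close>, so that \<open>det M\<close> is the characteristic polynomial, let \<open>q = x - c\<close>, and extend \<open>w\<close> and a basis \<open>B\<close> of the
  eigenspace with \<open>u \<in> B\<close> to a basis of the whole space. Since \<open>M w = q w - u\<close>, we have
  \<open>M (q w + u) = q\<^sup>2 w\<close>. Replacing \<open>w\<close> by \<open>q w + u\<close> multiplies the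
  determinant of the basis by \<open>q\<close>, while applying \<open>M\<close> to the modified basis yields a determinant
  divisible by \<open>q\<close> to the power \<open>card B + 2\<close>. Hence \<open>q\<close> to the power \<open>card B + 1\<close> divides
  the characteristic polynomial.
\<close>
lemma defective_if_chain:
  fixes A :: "complex^'n^'n"
  assumes u: "A *v u = c *s u" "u \<noteq> 0" and w: "A *v w = c *s w + u"
  shows "defective A"
proof -
  define E where "E = {v. A *v v = c *s v}"
  have subE: "vec.subspace E"
    unfolding E_def by (rule vec.subspaceI)
      (auto simp: matrix_vector_right_distrib vec.scale vector_add_ldistrib vector_smult_assoc mult.commute)
  obtain B where B: "{u} \<subseteq> B" "B \<subseteq> E" "vec.independent B" "E \<subseteq> vec.span B"
    using vec.maximal_independent_subset_extend[of "{u}" E] u by (auto simp: E_def)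
  have card_B: "card B = geom_mult A c"
    using vec.basis_card_eq_dim[OF B(2,4,3)] by (simp add: geom_mult_def E_def)
  have "w \<notin> E"
    using u w by (simp add: E_def)
  then have wB: "w \<notin> vec.span B"
    using vec.span_minimal[OF B(2) subE] by blast
  then have "w \<notin> B"
    using vec.span_base by blast
  define C where "C = vec.extend_basis (insert w B)"
  have ind: "vec.independent (insert w B)"
    using wB B(3) by (rule vec.independent_insertI)
  have C: "insert w B \<subseteq> C" "vec.independent C" "vec.span C = UNIV"
    unfolding C_def using ind
    by (rule vec.extend_basis_superset, rule vec.independent_extend_basis, rule vec.span_extend_basis)
  have "card C = CARD('n)"
    using vec.basis_card_eq_dim[of C UNIV] C(2,3) unfolding vec_dim_card by simp
  then obtain f :: "'n \<Rightarrow> complex^'n" where f: "bij_betw f UNIV C"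
    using finite_same_card_bij[of "UNIV :: 'n set" C] vec.finiteI_independent[OF C(2)] by auto
  then have inj: "inj f" and range_f: "range f = C"
    by (auto simp: bij_betw_def)
  have "u \<in> range f" "w \<in> range f"
    using C(1) B(1) by (auto simp: range_f)
  then obtain ju jw where ju: "f ju = u" and jw: "f jw = w"
    by blast
  define S where "S = f -` B"
  have card_S: "card S = card B"
    using C(1) range_f unfolding S_def by (intro card_vimage_inj inj) auto
  have "ju \<in> S" "jw \<notin> S"
    using ju jw B(1) \<open>w \<notin> B\<close> by (auto simp: S_def)

  define P where "P = (\<chi> j. f j)"
  have "rows P = C"
    using range_f by (auto simp: rows_def row_def P_def)
  then have "det P \<noteq> 0"
    using C(3) by (metis invertible_det_nz invertible_left_inverse matrix_left_invertible_span_rows_gen)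

  define q where "q = [:- c, 1:]"
  \<comment> \<open>\<open>cv\<close> turns a complex vector into a vector of constant polynomials,
    so that the polynomial matrix \<open>M\<close> can act on it.\<close>
  define cv where "cv v = (\<chi> i. [:v $ i:])" for v :: "complex^'n"
  define M where "M = mat [:0, 1:] - (\<chi> i j. [:A $ i $ j:])"
  have M_cv: "(M *v cv v) $ i = [:0, 1:] * [:v $ i:] - [:(A *v v) $ i:]" for v i
  proof -
    have const_sum: "(\<Sum>j\<in>I. [:h j:]) = [:\<Sum>j\<in>I. h j:]" for h :: "'n \<Rightarrow> complex" and I
      by (induction I rule: infinite_finite_induct) auto
    show ?thesis
      unfolding M_def matrix_vector_mult_diff_rdistrib
      by (simp add: cv_def matrix_vector_mult_def mat_def if_distribR if_distrib const_sum mult.commute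
          cong: if_cong)
  qed
  have cv_nth: "cv v $ i = [:v $ i:]" for v i
    by (simp add: cv_def)
  have M_E: "M *v cv v = q *s cv v" if "A *v v = c *s v" for v
    by (simp add: vec_eq_iff M_cv cv_nth that q_def)
  have "M *v (q *s cv w) = q *s (M *v cv w)"
    by (simp add: vec_eq_iff matrix_vector_mult_def sum_distrib_left mult_ac)
  also have "M *v cv w = q *s cv w - cv u"
    by (simp add: vec_eq_iff M_cv cv_nth w q_def)
  finally have M_w: "M *v (q *s cv w + cv u) = q\<^sup>2 *s cv w"
    by (simp add: matrix_vector_right_distrib M_E u vec_eq_iff right_diff_distrib power2_eq_square)

  define R where "R = (\<chi> j. if j = jw then q *s cv w + cv u else cv (f j))"
  have det_R: "det R = q * [:det P:]"
  proof -
    \<comment> \<open>Row \<open>jw\<close> of \<open>R\<close> is split by linearity. Its summand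
      \<open>cv u\<close> repeats row \<open>ju\<close>, so only the summand
      \<open>q *s cv w\<close> contributes.\<close>
    have "det (\<chi> j. if j = jw then cv u else cv (f j)) = 0"
      by (rule det_identical_rows[of ju jw]) (use \<open>ju \<in> S\<close> \<open>jw \<notin> S\<close> ju in \<open>auto simp: row_def\<close>)
    moreover have "(\<chi> j. if j = jw then cv w else cv (f j)) = (\<chi> j. cv (f j))"
      by (simp add: vec_eq_iff jw)
    moreover have "det (\<chi> j. cv (f j)) = [:det P:]"
    proof -
      have "(\<Prod>j\<in>I. [:h j:]) = [:\<Prod>j\<in>I. h j:]" for h :: "'n \<Rightarrow> complex" and I
        by (induction I rule: infinite_finite_induct) auto
      moreover have "(\<Sum>j\<in>I. [:h j:]) = [:\<Sum>j\<in>I. h j:]" for h :: "('n \<Rightarrow> 'n) \<Rightarrow> complex" and I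
        by (induction I rule: infinite_finite_induct) auto
      ultimately show ?thesis
        by (simp add: det_def P_def cv_def of_int_poly mult.commute)
    qed
    ultimately show ?thesis
      unfolding R_def by (simp add: det_row_add det_row_mul)
  qed

  \<comment> \<open>\<open>d j\<close> is the power of \<open>q\<close> that splits off from
    \<open>M *v (R $ j)\<close>, and \<open>N j\<close> is what remains.\<close>
  define d where "d j = (if j = jw then q\<^sup>2 else if j \<in> S then q else 1)" for j
  define N where "N j = (if j = jw \<or> j \<in> S then cv (f j) else M *v cv (f j))" for j
  \<comment> \<open>The basis vectors are the rows of \<open>R\<close>, so multiplying by
    \<open>transpose M\<close> on the right applies \<open>M\<close> to each of them.\<close>
  have "R ** transpose M = (\<chi> j. M *v (R $ j))"
    by (simp add: vec_eq_iff matrix_matrix_mult_def matrix_vector_mult_def transpose_def mult.commute)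
  also have "\<dots> = (\<chi> j. d j *s N j)"
  proof -
    have "M *v (R $ j) = d j *s N j" for j
    proof (cases "j \<in> S")
      case True
      then have "A *v f j = c *s f j" "j \<noteq> jw"
        using B(2) \<open>jw \<notin> S\<close> by (auto simp: S_def E_def)
      then show ?thesis
        using True by (simp add: R_def d_def N_def M_E)
    qed (auto simp: R_def d_def N_def M_w jw)
    then show ?thesis
      by simp
  qed
  finally have "det (R ** transpose M) = (\<Prod>j\<in>UNIV. d j) * det (\<chi> j. N j)"
    by (simp add: det_rows_mul)
  then have "det R * charpoly A = (\<Prod>j\<in>UNIV. d j) * det (\<chi> j. N j)"
    by (simp add: det_mul M_def charpoly_def)
  moreover have "(\<Prod>j\<in>UNIV. d j) = q ^ (card B + 2)"
  proof -
    have "(\<Prod>j\<in>UNIV. d j) = (\<Prod>j\<in>insert jw S. d j)"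
      by (rule prod.mono_neutral_right) (auto simp: d_def)
    also have "\<dots> = q\<^sup>2 * (\<Prod>j\<in>S. d j)"
      using \<open>jw \<notin> S\<close> by (simp add: d_def)
    also have "(\<Prod>j\<in>S. d j) = (\<Prod>j\<in>S. q)"
      using \<open>jw \<notin> S\<close> by (intro prod.cong) (auto simp: d_def)
    finally show ?thesis
      by (simp add: card_S power_add power2_eq_square mult.commute)
  qed
  \<comment> \<open>One of the \<open>card B + 2\<close> factors \<open>q\<close> cancels against
    that of \<open>det R\<close>; the remaining exponent exceeds the geometric multiplicity by
    one.\<close>
  ultimately have "q * ([:det P:] * charpoly A) = q * (q ^ (card B + 1) * det (\<chi> j. N j))"
    by (simp add: det_R mult_ac power_add power2_eq_square)
  moreover have "q \<noteq> 0"
    by (simp add: q_def)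
  ultimately have "[:det P:] * charpoly A = q ^ (card B + 1) * det (\<chi> j. N j)"
    by (simp only: mult_cancel_left simp_thms)
  then have "q ^ (card B + 1) dvd smult (det P) (charpoly A)"
    by simp
  then have "q ^ (card B + 1) dvd charpoly A"
    using \<open>det P \<noteq> 0\<close> dvd_smult_cancel by blast
  then have "geom_mult A c < alg_mult A c"
    by (simp only: q_def order_divides alg_mult_def) (simp add: charpoly_nonzero card_B)
  then show ?thesis
    using u by (auto simp: defective_def mat_eigenvalue_def)
qed

section \<open>Comparing the multiplicities and perturbing to a defective matrix\<close>

text \<open>An eigenvector makes the geometric multiplicity at least 1, so a strictly larger
  algebraic one is at least 2.\<close>

lemma defective_imp_has_multiple_eigenvalues:
  fixes A :: "'a::field^'n^'n"
  assumes "defective A"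
  shows "has_multiple_eigenvalues A"
proof -
  obtain c where c: "mat_eigenvalue A c" "geom_mult A c < alg_mult A c"
    using assms by (auto simp: defective_def)
  then have "geom_mult A c \<noteq> 0"
    by (auto simp: mat_eigenvalue_def geom_mult_def)
  with c show ?thesis
    by (auto simp: has_multiple_eigenvalues_def intro!: exI[of _ c])
qed

lemma in_closure_defective_if_geom_mult:
  fixes A :: "complex^'n^'n"
  assumes "geom_mult A c \<ge> 2"
  shows "A \<in> closure {A. defective A}"
proof -
  obtain B where B: "B \<subseteq> {v. A *v v = c *s v}" "vec.independent B" "card B = geom_mult A c"
    unfolding geom_mult_def by (rule vec.basis_exists)
  have "\<not> card B \<le> Suc 0"
    using assms B(3) by simp
  then obtain u v where uv: "u \<in> B" "v \<in> B" "u \<noteq> v"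
    using card_le_Suc0_iff_eq[OF vec.finiteI_independent[OF B(2)]] by blast
  then have eig: "A *v u = c *s u" "A *v v = c *s v" and "u \<noteq> 0"
    using B(1,2) vec.dependent_zero by auto
  \<comment> \<open>On the basis \<open>B\<close> of the eigenspace, \<open>g\<close> sends
    \<open>v\<close> to \<open>u\<close> and all other vectors, including \<open>u\<close>, to
    0.\<close>
  obtain g where g: "Vector_Spaces.linear (*s) (*s) g" "g u = 0" "g v = u"
    using vec.linear_independent_extend[OF B(2), of "\<lambda>x. if x = v then u else 0"] uv by auto
  define N where "N = matrix g"
  have N: "N *v u = 0" "N *v v = u"
    by (simp_all add: N_def matrix_works g)
  \<comment> \<open>\<open>mat e ** N\<close> is the complex scalar multiple of \<open>N\<close> by
    \<open>e\<close>.\<close>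
  have smult_add: "(A + mat e ** N) *v x = A *v x + e *s (N *v x)" for e x
    by (simp add: matrix_vector_mult_add_rdistrib flip: matrix_vector_mul_assoc)
       (simp add: matrix_vector_mult_def mat_def vec_eq_iff if_distrib if_distribR cong: if_cong)
  have "defective (A + mat e ** N)" if "e \<noteq> 0" for e
    by (rule defective_if_chain[of _ "e *s u" c v])
       (simp_all add: smult_add N eig vec.scale vector_smult_assoc mult.commute \<open>u \<noteq> 0\<close> that)
  moreover define e :: "nat \<Rightarrow> complex" where "e k = of_real (inverse (real (Suc k)))" for k
  moreover have "e k \<noteq> 0" for k
    unfolding e_def of_real_eq_0_iff by simp
  ultimately have def: "\<forall>k. A + mat (e k) ** N \<in> {A. defective A}"
    by simp
  have entry: "(mat e ** N) $ i $ j = e * N $ i $ j" for e i j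
    by (simp add: matrix_matrix_mult_def mat_def if_distrib if_distribR cong: if_cong)
  have "e \<longlonglongrightarrow> of_real 0"
    unfolding e_def by (intro tendsto_of_real LIMSEQ_inverse_real_of_nat)
  then have "(\<lambda>k. A $ i $ j + e k * N $ i $ j) \<longlonglongrightarrow> A $ i $ j + of_real 0 * N $ i $ j" for i j
    by (intro tendsto_intros)
  then have "(\<lambda>k. A + mat (e k) ** N) \<longlonglongrightarrow> A"
    by (intro vec_tendstoI) (simp add: entry)
  with def show ?thesis
    unfolding closure_sequential by (intro exI conjI)
qed

theorem proposition1:
  assumes "CARD('n::finite) \<ge> 2"
  shows "closure {A :: complex^'n^'n. defective A} = {A :: complex^'n^'n. has_multiple_eigenvalues A}"
proof (rule antisym)
  show "closure {A :: complex^'n^'n. defective A} \<subseteq> {A. has_multiple_eigenvalues A}"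
    by (intro closure_minimal closed_has_multiple_eigenvalues)
       (auto intro: defective_imp_has_multiple_eigenvalues)
  show "{A :: complex^'n^'n. has_multiple_eigenvalues A} \<subseteq> closure {A. defective A}"
  proof
    fix A :: "complex^'n^'n"
    assume "A \<in> {A. has_multiple_eigenvalues A}"
    then obtain c where c: "mat_eigenvalue A c" "alg_mult A c \<ge> 2"
      by (auto simp: has_multiple_eigenvalues_def)
    show "A \<in> closure {A. defective A}"
    \<comment> \<open>With algebraic multiplicity at least 2, a geometric multiplicity below 2 makes
      \<open>A\<close> itself defective; only the other case needs a perturbation.\<close>
    proof (cases "geom_mult A c \<ge> 2")
      case False
      with c have "defective A"
        by (auto simp: defective_def intro!: exI[of _ c])
      then show ?thesis
        by (simp add: closure_subset[THEN subsetD])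
    qed (rule in_closure_defective_if_geom_mult)
  qed
qed

end
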